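(* Let $G$ be a minimal factor-critical graph of order $n$. Then $\rho(G)\leq \rho\big(K_{1}\vee \tfrac{n-1}{2}K_{2}\big)$, with equality if and only if $G\cong K_{1}\vee \tfrac{n-1}{2}K_{2}$.
   Context: All graphs are finite, simple and connected. $\rho(G)$ denotes the spectral radius (largest eigenvalue) of the adjacency matrix of $G$. A graph $G$ is factor-critical if $G-v$ has a perfect matching for every vertex $v\in V(G)$. A factor-critical graph $G$ is minimal factor-critical if $G-e$ is not factor-critical for every edge $e\in E(G)$. $K_1\vee \frac{n-1}{2}K_2$ denotes the join of a single vertex with the disjoint union of $\frac{n-1}{2}$ copies of $K_2$ (i.e., $\frac{n-1}{2}$ triangles sharing one common vertex). *)

theory Defs
  imports "Graph_Theory.Graph_Theory" "Jordan_Normal_Form.Spectral_Radius"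
begin

text \<open>
  A finite simple graph is an instance of the locale \<^locale>\<open>graph\<close>: a finite, loop-free digraph
  without parallel arcs whose arc relation is symmetric. An undirected edge \<open>{u, v}\<close> is thus
  represented by the two arcs with ends \<open>(u, v)\<close> and \<open>(v, u)\<close>.
\<close>

definition uedges :: "('a, 'b) pre_digraph \<Rightarrow> 'a set set" where
  "uedges G = {{u, v} | u v. (u, v) \<in> arcs_ends G}"

definition del_uedge :: "('a, 'b) pre_digraph \<Rightarrow> 'a set \<Rightarrow> ('a, 'b) pre_digraph" where
  "del_uedge G e = G\<lparr>arcs := {a \<in> arcs G. {tail G a, head G a} \<noteq> e}\<rparr>"

definition matching :: "('a, 'b) pre_digraph \<Rightarrow> 'a set set \<Rightarrow> bool" where
  "matching G M \<longleftrightarrow> M \<subseteq> uedges G \<and> pairwise disjnt M"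

definition perfect_matching :: "('a, 'b) pre_digraph \<Rightarrow> 'a set set \<Rightarrow> bool" where
  "perfect_matching G M \<longleftrightarrow> matching G M \<and> \<Union>M = verts G"

definition factor_critical :: "('a, 'b) pre_digraph \<Rightarrow> bool" where
  "factor_critical G \<longleftrightarrow> (\<forall>v \<in> verts G. \<exists>M. perfect_matching (pre_digraph.del_vert G v) M)"

definition minimal_factor_critical :: "('a, 'b) pre_digraph \<Rightarrow> bool" where
  "minimal_factor_critical G \<longleftrightarrow>
     factor_critical G \<and> (\<forall>e \<in> uedges G. \<not> factor_critical (del_uedge G e))"

definition adjacency_matrix :: "('a, 'b) pre_digraph \<Rightarrow> 'a list \<Rightarrow> complex mat" where
  "adjacency_matrix G vs = mat (length vs) (length vs)
     (\<lambda>(i, j). if (vs ! i, vs ! j) \<in> arcs_ends G then 1 else 0)"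

text \<open>
  The rows and columns are indexed by an arbitrary enumeration of the vertices; the lemma
  \<open>graph_spectral_radius_eq\<close> below shows that the choice does not matter. The adjacency matrix is
  symmetric and nonnegative, so its spectral radius is its largest eigenvalue.
\<close>

definition graph_spectral_radius :: "('a, 'b) pre_digraph \<Rightarrow> real" where
  "graph_spectral_radius G =
     spectral_radius (adjacency_matrix G (SOME vs. distinct vs \<and> set vs = verts G))"

definition complete_graph :: "nat \<Rightarrow> nat pair_pre_digraph" where
  "complete_graph n = \<lparr>pverts = {..<n}, parcs = {(i, j). i < n \<and> j < n \<and> i \<noteq> j}\<rparr>"

definition disjoint_copies :: "nat \<Rightarrow> 'a pair_pre_digraph \<Rightarrow> (nat \<times> 'a) pair_pre_digraph" where
  "disjoint_copies k H =
     \<lparr>pverts = {..<k} \<times> pverts H,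
      parcs = {((i, u), (i, v)) | i u v. i < k \<and> (u, v) \<in> parcs H}\<rparr>"

definition graph_join ::
  "'a pair_pre_digraph \<Rightarrow> 'b pair_pre_digraph \<Rightarrow> ('a + 'b) pair_pre_digraph" where
  "graph_join G H =
     \<lparr>pverts = pverts G <+> pverts H,
      parcs = {(Inl u, Inl v) | u v. (u, v) \<in> parcs G} \<union> {(Inr u, Inr v) | u v. (u, v) \<in> parcs H}
        \<union> {(Inl u, Inr v) | u v. u \<in> pverts G \<and> v \<in> pverts H}
        \<union> {(Inr v, Inl u) | u v. u \<in> pverts G \<and> v \<in> pverts H}\<rparr>"

definition friendship_graph :: "nat \<Rightarrow> (nat + nat \<times> nat) pair_pre_digraph" where
  "friendship_graph k = graph_join (complete_graph 1) (disjoint_copies k (complete_graph 2))"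

lemma spectrum_adjacency_matrix_subset:
  assumes vs: "distinct vs" and ws: "distinct ws" and eq: "set vs = set ws"
  shows "spectrum (adjacency_matrix G vs) \<subseteq> spectrum (adjacency_matrix G ws)"
proof
  fix k assume "k \<in> spectrum (adjacency_matrix G vs)"
  then obtain x where x: "eigenvector (adjacency_matrix G vs) x k"
    by (auto simp: spectrum_def eigenvalue_def)
  define n where "n = length vs"
  have lw: "length ws = n"
    unfolding n_def using vs ws eq by (metis distinct_card)
  let ?A = "adjacency_matrix G vs" and ?B = "adjacency_matrix G ws"
  have dims: "dim_row ?A = n" "dim_col ?A = n" "dim_row ?B = n" "dim_col ?B = n"
    by (auto simp: adjacency_matrix_def n_def[symmetric] lw)
  define p where "p i = (THE j. j < n \<and> vs ! j = ws ! i)" for i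
  have p: "p i < n \<and> vs ! p i = ws ! i" if "i < n" for i
  proof -
    have "ws ! i \<in> set vs" using that lw eq by simp
    then obtain j where j: "j < n" "vs ! j = ws ! i" by (auto simp: in_set_conv_nth n_def)
    have "\<exists>!j. j < n \<and> vs ! j = ws ! i"
      using j vs by (metis n_def nth_eq_iff_index_eq)
    from theI'[OF this] show ?thesis by (simp add: p_def)
  qed
  have inj: "inj_on p {..<n}"
    by (rule inj_onI) (metis lessThan_iff lw nth_eq_iff_index_eq p ws)
  have bij: "bij_betw p {..<n} {..<n}"
    unfolding bij_betw_def using inj p
    by (metis (no_types, lifting) endo_inj_surj finite_lessThan image_subsetI lessThan_iff)
  have xc: "dim_vec x = n" "x \<noteq> 0\<^sub>v n" and ev: "?A *\<^sub>v x = k \<cdot>\<^sub>v x"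
    using x dims by (auto simp: eigenvector_def)
  define y where "y = vec n (\<lambda>i. x $ p i)"
  have "y \<noteq> 0\<^sub>v n"
  proof
    assume y0: "y = 0\<^sub>v n"
    have "x $ j = 0" if "j < n" for j
    proof -
      have "j \<in> p ` {..<n}" using bij that by (simp add: bij_betw_def)
      then obtain i where i: "i < n" "j = p i" by auto
      have "y $ i = 0" using y0 i by simp
      then show ?thesis using i by (simp add: y_def)
    qed
    then have "x = 0\<^sub>v n" using xc by (intro eq_vecI) auto
    then show False using xc by simp
  qed
  moreover have "?B *\<^sub>v y = k \<cdot>\<^sub>v y"
  proof (rule eq_vecI)
    fix i assume "i < dim_vec (k \<cdot>\<^sub>v y)"
    then have i: "i < n" by (simp add: y_def)
    have "(?B *\<^sub>v y) $ i
        = (\<Sum>j<n. (if (ws ! i, ws ! j) \<in> arcs_ends G then 1 else 0) * x $ p j)"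
      using i lw by (simp add: adjacency_matrix_def scalar_prod_def y_def lessThan_atLeast0)
    also have "\<dots> = (\<Sum>j<n. (if (vs ! p i, vs ! p j) \<in> arcs_ends G then 1 else 0) * x $ p j)"
      using p i by (intro sum.cong) auto
    also have "\<dots> = (\<Sum>j<n. (if (vs ! p i, vs ! j) \<in> arcs_ends G then 1 else 0) * x $ j)"
      by (rule sum.reindex_bij_betw[OF bij])
    also have "\<dots> = (?A *\<^sub>v x) $ p i"
      using p[OF i] xc
      by (simp add: adjacency_matrix_def scalar_prod_def n_def[symmetric] lessThan_atLeast0)
    also have "\<dots> = (k \<cdot>\<^sub>v y) $ i"
      using ev p[OF i] xc i by (simp add: y_def)
    finally show "(?B *\<^sub>v y) $ i = (k \<cdot>\<^sub>v y) $ i" .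
  qed (use dims in \<open>auto simp: y_def\<close>)
  ultimately have "eigenvector ?B y k"
    using dims by (auto simp: eigenvector_def y_def)
  then show "k \<in> spectrum ?B" by (auto simp: spectrum_def eigenvalue_def)
qed

lemma graph_spectral_radius_eq:
  assumes "distinct vs" and "set vs = verts G"
  shows "graph_spectral_radius G = spectral_radius (adjacency_matrix G vs)"
proof -
  let ?ws = "SOME vs. distinct vs \<and> set vs = verts G"
  have "distinct ?ws \<and> set ?ws = verts G"
    by (rule someI[where x = vs]) (use assms in auto)
  then have "spectrum (adjacency_matrix G ?ws) = spectrum (adjacency_matrix G vs)"
    using assms by (intro equalityI spectrum_adjacency_matrix_subset) auto
  then show ?thesis by (simp add: graph_spectral_radius_def spectral_radius_def)
qed

lemma pair_graph_friendship_graph: "pair_graph (friendship_graph k)"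
proof -
  let ?F = "friendship_graph k"
  note defs = friendship_graph_def graph_join_def complete_graph_def disjoint_copies_def
  have V: "finite (pverts ?F)" by (simp add: defs)
  have wf: "e \<in> parcs ?F \<Longrightarrow> fst e \<in> pverts ?F \<and> snd e \<in> pverts ?F \<and> fst e \<noteq> snd e" for e
    by (auto simp: defs)
  then have "parcs ?F \<subseteq> pverts ?F \<times> pverts ?F" by fastforce
  then have "finite (parcs ?F)" using V by (meson finite_SigmaI finite_subset)
  moreover have "sym (parcs ?F)" by (rule symI) (auto simp: defs)
  ultimately show ?thesis
    using V wf by unfold_locales (simp_all add: symmetric_def)
qed

lemma card_friendship_graph: "card (pverts (friendship_graph k)) = 2 * k + 1"
  by (simp add: friendship_graph_def graph_join_def complete_graph_def disjoint_copies_def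
      card_Plus)

end

theory Submission
  imports Defs
begin

text \<open>
  Every factor-critical graph has an odd ear decomposition starting at any prescribed vertex \<open>v\<close>, and
  minimality forces the decomposition to use every edge, each ear bringing at least two new vertices.
  An ear creates at most two new paths of length two that start at \<open>v\<close>, so there are at most
  \<open>n - 1\<close> such paths. In terms of the adjacency matrix \<open>A\<close> and the degree vector \<open>d = A 1\<close> this is
  \<open>A d - d \<le> (n - 1) 1\<close>, and testing with \<open>d + (r - 1) 1\<close>, where \<open>r (r - 1) = n - 1\<close>, gives
  \<open>\<rho>(G) \<le> r\<close>; the friendship graph has the eigenvalue \<open>r\<close>. In case of equality, connectedness makes all
  counts equal to \<open>n - 1\<close>. The last ear contains adjacent vertices \<open>x\<close>, \<open>y\<close> of degree two, and the
  count at \<open>x\<close> shows that its other neighbour \<open>p\<close> is adjacent to everything; the count at \<open>p\<close> then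
  leaves room only for a perfect matching in \<open>G - p\<close>.
\<close>

section \<open>Odd ear decompositions\<close>

text \<open>A perfect matching on \<open>X\<close> is encoded by its partner map, so adjoining an
  edge is a mere function update. For irreflexive \<open>E\<close> the map \<open>m\<close> has no
  fixed point in \<open>X\<close>.\<close>

definition matchable :: "('a \<times> 'a) set \<Rightarrow> 'a set \<Rightarrow> bool" where
  "matchable E X \<longleftrightarrow> (\<exists>m. \<forall>x\<in>X. m x \<in> X \<and> m (m x) = x \<and> (x, m x) \<in> E)"

lemma matchable_empty [simp]: "matchable E {}"
  by (simp add: matchable_def)

lemma matchable_mono: "matchable E X \<Longrightarrow> E \<subseteq> F \<Longrightarrow> matchable F X"
  unfolding matchable_def by blast

text \<open>The set \<open>Y\<close> is tied to \<open>X\<close> by an equation so that the rule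
  applies directly to differences such as \<open>S - {w}\<close>.\<close>

lemma matchable_insert_pair:
  assumes "matchable E X" "E \<subseteq> F" "(x, y) \<in> F" "(y, x) \<in> F" "x \<noteq> y" "x \<notin> X" "y \<notin> X"
    and "Y = insert x (insert y X)"
  shows "matchable F Y"
proof -
  obtain m where m: "\<forall>x\<in>X. m x \<in> X \<and> m (m x) = x \<and> (x, m x) \<in> E"
    using assms(1) by (auto simp: matchable_def)
  have "\<forall>u\<in>Y. (m(x := y, y := x)) u \<in> Y \<and> (m(x := y, y := x)) ((m(x := y, y := x)) u) = u
      \<and> (u, (m(x := y, y := x)) u) \<in> F"
    using m assms by auto
  then show ?thesis unfolding matchable_def by blast
qed

text \<open>For symmetric \<open>E\<close> the cardinality is the row sum of \<open>A^2 - D\<close>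
  at \<open>v\<close>, where \<open>A\<close> is the adjacency matrix and \<open>D\<close> the
  diagonal matrix of degrees. This row sum is what the spectral bound needs.\<close>

definition two_paths :: "('a \<times> 'a) set \<Rightarrow> 'a \<Rightarrow> ('a \<times> 'a) set" where
  "two_paths E v = {(w, u). (v, w) \<in> E \<and> (w, u) \<in> E \<and> u \<noteq> v}"

lemma finite_two_paths: "finite S \<Longrightarrow> E \<subseteq> S \<times> S \<Longrightarrow> finite (two_paths E v)"
  by (rule finite_subset[of _ "S \<times> S"]) (auto simp: two_paths_def)

text \<open>These are the properties that ear addition preserves and the theorem needs, rather than the
  decomposition itself; the vertices \<open>x\<close>, \<open>y\<close> are found on the last ear.\<close>

definition odd_ear_graph :: "'a \<Rightarrow> 'a set \<Rightarrow> ('a \<times> 'a) set \<Rightarrow> bool" where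
  "odd_ear_graph v T F \<longleftrightarrow> finite T \<and> v \<in> T \<and> F \<subseteq> T \<times> T \<and> sym F \<and> irrefl F
     \<and> (\<forall>w\<in>T. matchable F (T - {w})) \<and> card (two_paths F v) + 1 \<le> card T
     \<and> (T = {v} \<or> (\<exists>x y p. F `` {x} = {y, p} \<and> card (F `` {y}) \<le> 2))"

text \<open>\<open>S\<close> consists of the finished part \<open>T\<close> and an unfinished ear with free end \<open>z\<close>. For every second
  inner vertex \<open>w\<close> of the ear, \<open>S - {w}\<close> becomes matchable only when \<open>z\<close> is joined to some \<open>b \<in> T\<close>.\<close>

definition dangling_ear :: "'a \<Rightarrow> 'a set \<Rightarrow> 'a set \<Rightarrow> ('a \<times> 'a) set \<Rightarrow> 'a \<Rightarrow> bool" where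
  "dangling_ear v T S F z \<longleftrightarrow> finite S \<and> v \<in> T \<and> T \<subseteq> S \<and> z \<in> S - T \<and> F \<subseteq> S \<times> S
     \<and> sym F \<and> irrefl F
     \<and> (\<forall>w\<in>insert z T. matchable F (S - {w}))
     \<and> (\<forall>w\<in>S. matchable F (S - {w}) \<or> w \<noteq> z \<and> w \<notin> T \<and> (\<forall>b\<in>T. matchable F (S - {w, z, b})))
     \<and> card (two_paths F v) + 2 \<le> card S
     \<and> (\<exists>x\<in>S - T. F `` {z} = {x} \<and> card (F `` {x}) \<le> 2)"

section \<open>Building an ear two vertices at a time\<close>

lemma card_two_paths_add:
  assumes "finite (two_paths F v)" "two_paths F' v \<subseteq> insert q (two_paths F v)"
  shows "card (two_paths F' v) \<le> card (two_paths F v) + 1"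
proof -
  have "card (two_paths F' v) \<le> card (insert q (two_paths F v))"
    using assms by (intro card_mono) auto
  also have "\<dots> \<le> card (two_paths F v) + 1"
    using assms(1) by (simp add: card_insert_if)
  finally show ?thesis .
qed

text \<open>The ear leaves \<open>T\<close> at \<open>a\<close> and has inner vertices
  \<open>x\<close>, \<open>y\<close> so far. If \<open>w\<close> in \<open>T\<close> is missing, the
  edge \<open>x y\<close> extends a matching of \<open>T - {w}\<close>; if \<open>y\<close> is
  missing, the edge \<open>a x\<close> extends one of \<open>T - {a}\<close>. If \<open>x\<close> is
  missing, then \<open>y\<close> must wait for its partner \<open>b\<close>, and a matching of
  \<open>T - {b}\<close> serves.\<close>

lemma dangling_ear_start:
  assumes H: "odd_ear_graph v T F" and a: "a \<in> T" and xy: "x \<notin> T" "y \<notin> T" "x \<noteq> y"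
  shows "dangling_ear v T (insert x (insert y T)) (F \<union> {(a, x), (x, a), (x, y), (y, x)}) y"
    (is "dangling_ear v T ?S ?F y")
proof -
  have fin: "finite T" and v: "v \<in> T" and FT: "F \<subseteq> T \<times> T" and s: "sym F" and ir: "irrefl F"
    and fc: "\<And>w. w \<in> T \<Longrightarrow> matchable F (T - {w})" and cd: "card (two_paths F v) + 1 \<le> card T"
    using H by (auto simp: odd_ear_graph_def)
  have m1: "matchable ?F (?S - {w})" if "w \<in> T" for w
    by (rule matchable_insert_pair[OF fc[OF that], of ?F x y]) (use that xy in auto)
  have m2: "matchable ?F (?S - {y})"
    by (rule matchable_insert_pair[OF fc[OF a], of ?F x a]) (use a xy in auto)
  have m3: "matchable ?F (?S - {x, y, b})" if "b \<in> T" for b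
  proof -
    have "?S - {x, y, b} = T - {b}" using xy by auto
    then show ?thesis using fc[OF that] by (auto intro: matchable_mono)
  qed
  \<comment> \<open>The only possible new path from \<open>v\<close> enters the ear through
    \<open>a\<close>: it is \<open>v a x\<close> if \<open>v\<close> differs from \<open>a\<close>,
    and \<open>v x y\<close> otherwise. One new path against two new vertices leaves room for the
    one that closing the ear may add.\<close>
  have "two_paths ?F v \<subseteq> insert (if v = a then (x, y) else (a, x)) (two_paths F v)"
    using FT v a xy ir by (auto simp: two_paths_def irrefl_def)
  then have "card (two_paths ?F v) \<le> card (two_paths F v) + 1"
    by (rule card_two_paths_add[OF finite_two_paths[OF fin FT]])
  moreover have "card ?S = card T + 2" using fin xy by simp
  ultimately have c: "card (two_paths ?F v) + 2 \<le> card ?S" using cd by linarith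
  have "?F `` {y} = {x}" "?F `` {x} = {a, y}" using FT xy a by auto
  then have e: "\<exists>x\<in>?S - T. ?F `` {y} = {x} \<and> card (?F `` {x}) \<le> 2"
    using xy by (intro bexI[of _ x]) (auto simp: card_insert_if)
  have "?F \<subseteq> ?S \<times> ?S" using FT a by auto
  moreover have "sym ?F" using s by (auto simp: sym_def)
  moreover have "irrefl ?F" using ir xy a by (auto simp: irrefl_def)
  moreover have "matchable ?F (?S - {w}) \<or> w \<noteq> y \<and> w \<notin> T \<and> (\<forall>b\<in>T. matchable ?F (?S - {w, y, b}))"
    if "w \<in> ?S" for w
    using that m1 m2 m3 xy by auto
  ultimately show ?thesis
    unfolding dangling_ear_def using fin v xy c e m1 m2 by blast
qed

text \<open>The free end moves from \<open>z\<close> to \<open>y\<close>. Matchings of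
  \<open>S - {w}\<close> gain the edge \<open>x y\<close>. The vertex \<open>x\<close> joins those
  that wait for the ear to be closed; for the older ones \<open>z\<close> is no longer waiting and
  is matched with \<open>x\<close>, as it also is when \<open>y\<close> is missing.\<close>

lemma dangling_ear_extend:
  assumes H: "dangling_ear v T S F z" and xy: "x \<notin> S" "y \<notin> S" "x \<noteq> y"
  shows "dangling_ear v T (insert x (insert y S)) (F \<union> {(z, x), (x, z), (x, y), (y, x)}) y"
    (is "dangling_ear v T ?S ?F y")
proof -
  have fin: "finite S" and v: "v \<in> T" and T: "T \<subseteq> S" and z: "z \<in> S" "z \<notin> T"
    and FS: "F \<subseteq> S \<times> S" and s: "sym F" and ir: "irrefl F"
    and ma: "\<And>w. w \<in> insert z T \<Longrightarrow> matchable F (S - {w})"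
    and mb: "\<And>w. w \<in> S \<Longrightarrow> matchable F (S - {w})
              \<or> w \<noteq> z \<and> w \<notin> T \<and> (\<forall>b\<in>T. matchable F (S - {w, z, b}))"
    and cd: "card (two_paths F v) + 2 \<le> card S"
    using H by (auto simp: dangling_ear_def)
  obtain x' where x': "x' \<in> S - T" "F `` {z} = {x'}"
    using H by (auto simp: dangling_ear_def)
  have vz: "(v, z) \<notin> F"
    using x' v symD[OF s, of v z] by auto
  have m1: "matchable ?F (?S - {w})" if "w \<in> S" "matchable F (S - {w})" for w
    by (rule matchable_insert_pair[OF that(2), of ?F x y]) (use that xy in auto)
  have m2: "matchable ?F (?S - {y})"
    by (rule matchable_insert_pair[OF ma[of z], of ?F x z]) (use z xy in auto)
  have m3: "matchable ?F (?S - {x, y, b})" if "b \<in> T" for b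
  proof -
    have "?S - {x, y, b} = S - {b}" using xy by auto
    then show ?thesis using ma[of b] that by (auto intro: matchable_mono)
  qed
  have m4: "matchable ?F (?S - {w, y, b})"
    if "w \<in> S" "w \<noteq> z" "b \<in> T" "matchable F (S - {w, z, b})" for w b
    by (rule matchable_insert_pair[OF that(4), of ?F x z]) (use that xy z T in auto)
  have m5: "matchable ?F (?S - {w}) \<or> w \<noteq> y \<and> w \<notin> T \<and> (\<forall>b\<in>T. matchable ?F (?S - {w, y, b}))"
    if w: "w \<in> ?S" for w
  proof -
    consider "w = y" | "w = x" | "w \<in> S" "matchable F (S - {w})"
      | "w \<in> S" "w \<noteq> z" "w \<notin> T" "\<forall>b\<in>T. matchable F (S - {w, z, b})"
      using w mb by blast
    then show ?thesis
    proof cases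
      case 1 then show ?thesis using m2 by simp
    next
      case 2 then show ?thesis using m3 xy T by blast
    next
      case 3 then show ?thesis using m1 by blast
    next
      case 4
      then have "w \<noteq> y" using xy by blast
      with 4 show ?thesis using m4 by blast
    qed
  qed
  \<comment> \<open>The new edges lie at \<open>z\<close>, \<open>x\<close> and \<open>y\<close>,
    none of which is adjacent to \<open>v\<close>: the only neighbour of \<open>z\<close> lies
    outside \<open>T\<close>. Hence inner extensions create no path from \<open>v\<close>.\<close>
  have "two_paths ?F v \<subseteq> two_paths F v"
    using FS v T z xy vz by (auto simp: two_paths_def)
  then have "card (two_paths ?F v) \<le> card (two_paths F v)"
    by (rule card_mono[OF finite_two_paths[OF fin FS]])
  moreover have "card ?S = card S + 2" using fin xy by simp
  ultimately have c: "card (two_paths ?F v) + 2 \<le> card ?S" using cd by linarith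
  have y_nb: "?F `` {y} = {x}" using FS xy z(1) by blast
  have x_nb: "?F `` {x} = {z, y}" using FS xy z(1) by blast
  have "x \<in> ?S - T" using xy T by blast
  moreover have "card (?F `` {x}) \<le> 2" unfolding x_nb by (simp add: card_insert_if)
  ultimately have e: "\<exists>x\<in>?S - T. ?F `` {y} = {x} \<and> card (?F `` {x}) \<le> 2"
    using y_nb by blast
  have "?F \<subseteq> ?S \<times> ?S" using FS z by auto
  moreover have "sym ?F" using s by (auto simp: sym_def)
  moreover have "irrefl ?F" using ir xy z by (auto simp: irrefl_def)
  moreover have "\<forall>w\<in>insert y T. matchable ?F (?S - {w})" using m1 m2 ma T by blast
  moreover have "\<forall>w\<in>?S. matchable ?F (?S - {w})
      \<or> w \<noteq> y \<and> w \<notin> T \<and> (\<forall>b\<in>T. matchable ?F (?S - {w, y, b}))"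
    by (rule ballI) (rule m5)
  moreover have "finite ?S" using fin by simp
  moreover have "T \<subseteq> ?S" "y \<in> ?S - T" using T xy by blast+
  ultimately show ?thesis
    unfolding dangling_ear_def using v c e by (intro conjI)
qed

text \<open>The edge \<open>z b\<close> supplies the pair that the waiting vertices lack. The end
  \<open>b\<close> is any vertex of \<open>T\<close>, so the ear may also close up at the vertex
  where it started.\<close>

lemma dangling_ear_close:
  assumes H: "dangling_ear v T S F z" and b: "b \<in> T"
  shows "odd_ear_graph v S (F \<union> {(z, b), (b, z)})" (is "odd_ear_graph v S ?F")
proof -
  have fin: "finite S" and v: "v \<in> T" and T: "T \<subseteq> S" and z: "z \<in> S" "z \<notin> T"
    and FS: "F \<subseteq> S \<times> S" and s: "sym F" and ir: "irrefl F"
    and mb: "\<And>w. w \<in> S \<Longrightarrow> matchable F (S - {w})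
              \<or> w \<noteq> z \<and> w \<notin> T \<and> (\<forall>b\<in>T. matchable F (S - {w, z, b}))"
    and cd: "card (two_paths F v) + 2 \<le> card S"
    using H by (auto simp: dangling_ear_def)
  obtain x where x: "x \<in> S - T" "F `` {z} = {x}" "card (F `` {x}) \<le> 2"
    using H by (auto simp: dangling_ear_def)
  have vz: "(v, z) \<notin> F"
    using x v symD[OF s, of v z] by auto
  have m: "matchable ?F (S - {w})" if w: "w \<in> S" for w
    using mb[OF w]
  proof
    assume "matchable F (S - {w})"
    then show ?thesis by (rule matchable_mono) auto
  next
    assume *: "w \<noteq> z \<and> w \<notin> T \<and> (\<forall>b\<in>T. matchable F (S - {w, z, b}))"
    then have "matchable F (S - {w, z, b})" using b by blast
    then show ?thesis
      by (rule matchable_insert_pair[of _ _ ?F z b]) (use * w b z T in auto)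
  qed
  \<comment> \<open>The new edge gives either the path \<open>v b z\<close> or, if
    \<open>v = b\<close>, the path \<open>v z x\<close>.\<close>
  have "two_paths ?F v \<subseteq> insert (if v = b then (z, x) else (b, z)) (two_paths F v)"
    using FS v T z vz x(2) ir by (auto simp: two_paths_def irrefl_def)
  then have "card (two_paths ?F v) \<le> card (two_paths F v) + 1"
    by (rule card_two_paths_add[OF finite_two_paths[OF fin FS]])
  then have c: "card (two_paths ?F v) + 1 \<le> card S" using cd by linarith
  have "x \<noteq> z" using x(2) ir by (auto simp: irrefl_def)
  \<comment> \<open>The last two inner vertices of the ear are the witnesses: \<open>z\<close> has
    just gained its second neighbour, and the neighbours of \<open>x\<close> are unchanged.\<close>
  then have "?F `` {z} = {x, b}" "?F `` {x} = F `` {x}" using x b z by auto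
  then have e: "\<exists>x y p. ?F `` {x} = {y, p} \<and> card (?F `` {y}) \<le> 2"
    using x(3) by metis
  have "?F \<subseteq> S \<times> S" using FS z b T by auto
  moreover have "sym ?F" using s by (auto simp: sym_def)
  moreover have "irrefl ?F" using ir b z by (auto simp: irrefl_def)
  moreover have "v \<in> S" using v T by blast
  ultimately show ?thesis
    unfolding odd_ear_graph_def using fin c e m by blast
qed

section \<open>Odd ears that exhaust a connected factor-critical graph\<close>

locale factor_critical_rel =
  fixes V :: "'a set" and E :: "('a \<times> 'a) set"
  assumes finite_V: "finite V" and E_sub: "E \<subseteq> V \<times> V" and sym_E: "sym E" and irrefl_E: "irrefl E"
    and crit: "\<And>w. w \<in> V \<Longrightarrow> matchable E (V - {w})"
    and conn: "\<And>T. T \<noteq> {} \<Longrightarrow> T \<subset> V \<Longrightarrow> \<exists>a\<in>T. \<exists>b\<in>V - T. (a, b) \<in> E"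
begin

text \<open>Follow the matchings \<open>m\<close> of \<open>G - v\<close> and \<open>m'\<close> of \<open>G - b\<close> alternately from \<open>b\<close>; as \<open>m'\<close>
  pairs up the visited vertices other than \<open>b\<close> and the current end \<open>z\<close>, the walk never
  meets itself and must return to \<open>T\<close>.\<close>

lemma dangling_ear_completion:
  assumes m: "\<And>x. x \<in> V - {v} \<Longrightarrow> m x \<in> V - {v} \<and> m (m x) = x \<and> (x, m x) \<in> E"
    and m': "\<And>x. x \<in> V - {b} \<Longrightarrow> m' x \<in> V - {b} \<and> m' (m' x) = x \<and> (x, m' x) \<in> E"
    and "dangling_ear v T S F z" "S \<subseteq> V" "F \<subseteq> E" "\<And>x. x \<in> S - {v} \<Longrightarrow> m x \<in> S"
    and "b \<in> S - T" "b \<noteq> z" "\<And>x. x \<in> S - T - {b, z} \<Longrightarrow> m' x \<in> S - T - {b, z}"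
  shows "\<exists>T' F'. odd_ear_graph v T' F' \<and> S \<subseteq> T' \<and> T' \<subseteq> V \<and> F' \<subseteq> E \<and> (\<forall>x\<in>T' - {v}. m x \<in> T')"
  using assms(3-)
proof (induction "card (V - S)" arbitrary: S F z rule: less_induct)
  case less
  note d = less.prems(1)
  have T: "v \<in> T" "T \<subseteq> S" "z \<in> S" "z \<notin> T" using d by (auto simp: dangling_ear_def)
  define w where "w = m' z"
  have w: "w \<in> V" "w \<noteq> b" "m' w = z" "(z, w) \<in> E" "(w, z) \<in> E"
    using m'[of z] T less.prems(2,6) symD[OF sym_E, of z w] by (auto simp: w_def)
  have wz: "w \<noteq> z" using w(4) irrefl_E by (auto simp: irrefl_def)
  show ?case
  proof (cases "w \<in> T")
    case True
    have "odd_ear_graph v S (F \<union> {(z, w), (w, z)})"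
      by (rule dangling_ear_close[OF d True])
    then show ?thesis using less.prems w by blast
  next
    case False
    \<comment> \<open>A visited \<open>w\<close> outside \<open>T\<close> would have its
      \<open>m'\<close>-partner among the visited vertices other than \<open>b\<close> and
      \<open>z\<close>, but that partner is \<open>z\<close>.\<close>
    have wS: "w \<notin> S"
    proof
      assume "w \<in> S"
      then have "m' w \<in> S - T - {b, z}" using less.prems(7) False w wz by blast
      then show False using w by blast
    qed
    define y where "y = m w"
    have wv: "w \<in> V - {v}" using w wS T by blast
    then have y: "y \<in> V - {v}" "m y = w" "(w, y) \<in> E" "(y, w) \<in> E"
      using m[OF wv] symD[OF sym_E, of w y] by (auto simp: y_def)
    have yw: "w \<noteq> y" using y irrefl_E by (auto simp: irrefl_def)
    \<comment> \<open>Away from \<open>v\<close> the set \<open>S\<close> is closed under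
      \<open>m\<close>, so \<open>y\<close> in \<open>S\<close> would put its partner
      \<open>w\<close> in \<open>S\<close>.\<close>
    have yS: "y \<notin> S" using less.prems(4)[of y] y wS by blast
    let ?S = "insert w (insert y S)"
    let ?F = "F \<union> {(z, w), (w, z), (w, y), (y, w)}"
    have d': "dangling_ear v T ?S ?F y"
      by (rule dangling_ear_extend[OF d wS yS yw])
    have sub: "V - ?S \<subset> V - S" using w wS by blast
    have "\<exists>T' F'. odd_ear_graph v T' F' \<and> ?S \<subseteq> T' \<and> T' \<subseteq> V \<and> F' \<subseteq> E \<and> (\<forall>x\<in>T' - {v}. m x \<in> T')"
    proof (rule less.hyps[OF _ d'])
      show "card (V - ?S) < card (V - S)" using sub finite_V by (simp add: psubset_card_mono)
      show "?S \<subseteq> V" using w y less.prems by blast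
      show "?F \<subseteq> E" using w y less.prems by blast
      show "m x \<in> ?S" if "x \<in> ?S - {v}" for x
        using that less.prems(4) y by (auto simp: y_def)
      show "b \<in> ?S - T" "b \<noteq> y" using less.prems yS by auto
      \<comment> \<open>The step completes the \<open>m'\<close>-pair of \<open>z\<close> and
        \<open>w\<close>, and \<open>y\<close> takes over the role of the unpaired end.\<close>
      show "m' x \<in> ?S - T - {b, y}" if x: "x \<in> ?S - T - {b, y}" for x
      proof -
        consider "x = w" | "x = z" | "x \<in> S - T - {b, z}" using x by blast
        then show ?thesis
        proof cases
          case 1 then show ?thesis using w T less.prems yS by auto
        next
          case 2 then show ?thesis using w False yw by (auto simp: w_def)
        next
          case 3 then show ?thesis using less.prems(7) yS by blast
        qed
      qed
    qed
    then show ?thesis by blast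
  qed
qed

text \<open>An edge \<open>a b\<close> leaving \<open>T\<close> starts the ear. Since
  \<open>T\<close> is closed under \<open>m\<close> away from \<open>v\<close>, the partner of
  \<open>b\<close> is outside \<open>T\<close> too and becomes the second inner vertex. A matching
  of \<open>G - b\<close> then steers the ear back to \<open>T\<close>.\<close>

lemma odd_ear_graph_grow:
  assumes m: "\<And>x. x \<in> V - {v} \<Longrightarrow> m x \<in> V - {v} \<and> m (m x) = x \<and> (x, m x) \<in> E"
    and H: "odd_ear_graph v T F" "T \<subset> V" "F \<subseteq> E" "\<forall>x\<in>T - {v}. m x \<in> T"
  shows "\<exists>T' F'. odd_ear_graph v T' F' \<and> T \<subset> T' \<and> T' \<subseteq> V \<and> F' \<subseteq> E \<and> (\<forall>x\<in>T' - {v}. m x \<in> T')"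
proof -
  have v: "v \<in> T" using H by (auto simp: odd_ear_graph_def)
  then obtain a b where ab: "a \<in> T" "b \<in> V - T" "(a, b) \<in> E"
    using conn[of T] H(2) by blast
  have bv: "b \<in> V - {v}" using ab v by blast
  obtain m' where m': "\<And>x. x \<in> V - {b} \<Longrightarrow> m' x \<in> V - {b} \<and> m' (m' x) = x \<and> (x, m' x) \<in> E"
    using crit[of b] ab unfolding matchable_def by blast
  define y where "y = m b"
  have y: "y \<in> V - {v}" "m y = b" "(b, y) \<in> E" "(y, b) \<in> E"
    using m[OF bv] symD[OF sym_E, of b y] by (auto simp: y_def)
  have yb: "b \<noteq> y" using y irrefl_E by (auto simp: irrefl_def)
  have yT: "y \<notin> T" using H(4) y ab by blast
  have bT: "b \<notin> T" using ab by blast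
  let ?S = "insert b (insert y T)" and ?F = "F \<union> {(a, b), (b, a), (b, y), (y, b)}"
  have d: "dangling_ear v T ?S ?F y"
    by (rule dangling_ear_start[OF H(1) ab(1) bT yT yb])
  have "\<exists>T' F'. odd_ear_graph v T' F' \<and> ?S \<subseteq> T' \<and> T' \<subseteq> V \<and> F' \<subseteq> E \<and> (\<forall>x\<in>T' - {v}. m x \<in> T')"
  proof (rule dangling_ear_completion[OF m m' d])
    show "?S \<subseteq> V" using H ab y by blast
    show "?F \<subseteq> E" using H ab y symD[OF sym_E, of a b] by auto
    show "m x \<in> ?S" if "x \<in> ?S - {v}" for x
      using that H(4) y by (auto simp: y_def)
    show "b \<in> ?S - T" "b \<noteq> y" using bT yb by auto
    show "m' x \<in> ?S - T - {b, y}" if "x \<in> ?S - T - {b, y}" for x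
      using that by blast
  qed auto
  then show ?thesis using bT by blast
qed

text \<open>One matching \<open>m\<close> of \<open>G - v\<close> is fixed for all ears, since each
  new ear relies on the closure under \<open>m\<close> left by the earlier ones. The process starts
  with the single vertex \<open>v\<close> and ends because \<open>V - T\<close> shrinks.\<close>

lemma spanning_odd_ear_graph:
  assumes v: "v \<in> V"
  shows "\<exists>F \<subseteq> E. odd_ear_graph v V F"
proof -
  obtain m where m: "\<And>x. x \<in> V - {v} \<Longrightarrow> m x \<in> V - {v} \<and> m (m x) = x \<and> (x, m x) \<in> E"
    using crit[OF v] unfolding matchable_def by blast
  have "\<exists>F' \<subseteq> E. odd_ear_graph v V F'"
    if "odd_ear_graph v T F" "T \<subseteq> V" "F \<subseteq> E" "\<forall>x\<in>T - {v}. m x \<in> T" for T F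
    using that
  proof (induction "card (V - T)" arbitrary: T F rule: less_induct)
    case less
    show ?case
    proof (cases "T = V")
      case True
      then show ?thesis using less.prems by blast
    next
      case False
      then have "T \<subset> V" using less.prems by blast
      from odd_ear_graph_grow[OF m less.prems(1) this less.prems(3,4)]
      obtain T' F' where T': "odd_ear_graph v T' F'" "T \<subset> T'" "T' \<subseteq> V" "F' \<subseteq> E"
        "\<forall>x\<in>T' - {v}. m x \<in> T'" by blast
      have "V - T' \<subset> V - T" using T' by blast
      then have "card (V - T') < card (V - T)" using finite_V by (simp add: psubset_card_mono)
      from less.hyps[OF this T'(1,3-5)] show ?thesis .
    qed
  qed
  moreover have "odd_ear_graph v {v} {}"
    by (auto simp: odd_ear_graph_def two_paths_def sym_def irrefl_def)
  ultimately show ?thesis using v by blast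
qed

end

section \<open>Eigenvalues and paths of length two\<close>

text \<open>Transport along the enumeration \<open>vs\<close> turns the matrix product into a sum
  over neighbours, so that the later eigenvalue estimates need no indices.\<close>

lemma spectrum_adjacency_matrix_iff:
  assumes "wf_digraph G" and vs: "distinct vs" "set vs = verts G"
  shows "l \<in> spectrum (adjacency_matrix G vs) \<longleftrightarrow>
    (\<exists>x. (\<exists>u\<in>verts G. x u \<noteq> 0) \<and> (\<forall>u\<in>verts G. (\<Sum>w\<in>arcs_ends G `` {u}. x w) = l * x u))"
    (is "_ \<longleftrightarrow> (\<exists>x. ?P x)")
proof -
  interpret wf_digraph G by fact
  define n where "n = length vs"
  let ?A = "adjacency_matrix G vs"
  have bij: "bij_betw ((!) vs) {..<n} (verts G)"
    using bij_betw_nth[OF vs(1)] vs(2) by (auto simp: n_def)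
  have idx: "\<exists>i<n. u = vs ! i" if "u \<in> verts G" for u
    using bij that by (auto simp: bij_betw_def)
  have vsi: "vs ! i \<in> verts G" if "i < n" for i
    using bij that by (auto simp: bij_betw_def)
  have entry: "(?A *\<^sub>v y) $ i = (\<Sum>w\<in>arcs_ends G `` {vs ! i}. x w)"
    if y: "dim_vec y = n" "\<And>j. j < n \<Longrightarrow> y $ j = x (vs ! j)" and i: "i < n" for x y i
  proof -
    have "(?A *\<^sub>v y) $ i = (\<Sum>j<n. (if (vs ! i, vs ! j) \<in> arcs_ends G then 1 else 0) * x (vs ! j))"
      using i y by (simp add: adjacency_matrix_def scalar_prod_def n_def lessThan_atLeast0)
    also have "\<dots> = (\<Sum>w\<in>verts G. (if (vs ! i, w) \<in> arcs_ends G then 1 else 0) * x w)"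
      by (rule sum.reindex_bij_betw[OF bij])
    also have "\<dots> = (\<Sum>w\<in>arcs_ends G `` {vs ! i}. x w)"
    proof (rule sum.mono_neutral_cong_right)
      show "finite (verts G)" using vs(2) by (metis List.finite_set)
    qed (auto dest: adj_in_verts)
    finally show ?thesis .
  qed
  have "\<exists>x. ?P x" if "eigenvector ?A y l" for y
  proof -
    have y: "dim_vec y = n" "y \<noteq> 0\<^sub>v n" "?A *\<^sub>v y = l \<cdot>\<^sub>v y"
      using that by (auto simp: eigenvector_def adjacency_matrix_def n_def)
    define x where "x u = y $ (inv_into {..<n} ((!) vs) u)" for u
    have x: "y $ j = x (vs ! j)" if "j < n" for j
      using bij that by (simp add: x_def bij_betw_def inv_into_f_f)
    have "\<exists>i<n. y $ i \<noteq> 0"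
    proof (rule ccontr)
      assume "\<not> ?thesis"
      then have "y = 0\<^sub>v n" using y by (intro eq_vecI) auto
      then show False using y by simp
    qed
    then have "\<exists>u\<in>verts G. x u \<noteq> 0" using x vsi by metis
    moreover have "(\<Sum>w\<in>arcs_ends G `` {u}. x w) = l * x u" if u: "u \<in> verts G" for u
    proof -
      obtain i where i: "i < n" "u = vs ! i" using idx[OF u] by blast
      have "(\<Sum>w\<in>arcs_ends G `` {u}. x w) = (?A *\<^sub>v y) $ i"
        using entry[OF y(1) x] i by simp
      also have "\<dots> = l * x u" using y i x by simp
      finally show ?thesis .
    qed
    ultimately show ?thesis by blast
  qed
  moreover have "\<exists>y. eigenvector ?A y l" if x: "?P x" for x
  proof -
    define y where "y = vec n (\<lambda>i. x (vs ! i))"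
    have "?A *\<^sub>v y = l \<cdot>\<^sub>v y"
    proof (rule eq_vecI)
      fix i assume "i < dim_vec (l \<cdot>\<^sub>v y)"
      then have i: "i < n" by (simp add: y_def)
      have "(?A *\<^sub>v y) $ i = (\<Sum>w\<in>arcs_ends G `` {vs ! i}. x w)"
        by (rule entry) (auto simp: y_def i)
      also have "\<dots> = l * x (vs ! i)" using x vsi[OF i] by blast
      finally show "(?A *\<^sub>v y) $ i = (l \<cdot>\<^sub>v y) $ i" using i by (simp add: y_def)
    qed (auto simp: y_def adjacency_matrix_def n_def)
    moreover have "y \<noteq> 0\<^sub>v n"
    proof
      assume y0: "y = 0\<^sub>v n"
      obtain u where u: "u \<in> verts G" "x u \<noteq> 0" using x by blast
      obtain i where i: "i < n" "u = vs ! i" using idx[OF u(1)] by blast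
      have "y $ i = 0" using y0 i by simp
      then show False using i u by (simp add: y_def)
    qed
    moreover have "dim_row ?A = n" "y \<in> carrier_vec n"
      by (auto simp: adjacency_matrix_def n_def y_def)
    ultimately have "eigenvector ?A y l" by (simp add: eigenvector_def)
    then show ?thesis ..
  qed
  ultimately show ?thesis
    unfolding spectrum_def eigenvalue_def by blast
qed

lemma graph_spectral_radius_attained:
  assumes "fin_digraph G" "verts G \<noteq> {}"
  obtains l :: complex and x where "norm l = graph_spectral_radius G" "\<exists>u\<in>verts G. x u \<noteq> 0"
    "\<And>u. u \<in> verts G \<Longrightarrow> (\<Sum>w\<in>arcs_ends G `` {u}. x w) = l * x u"
proof -
  interpret fin_digraph G by fact
  obtain vs where vs: "distinct vs" "set vs = verts G"
    using finite_distinct_list[OF finite_verts] by blast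
  let ?A = "adjacency_matrix G vs"
  have "?A \<in> carrier_mat (length vs) (length vs)" "0 < length vs"
    using assms(2) vs by (auto simp: adjacency_matrix_def)
  from spectral_radius_mem_max(1)[OF this]
  obtain l where l: "l \<in> spectrum ?A" "norm l = graph_spectral_radius G"
    unfolding graph_spectral_radius_eq[OF vs] by auto
  then show thesis
    using that spectrum_adjacency_matrix_iff[OF wf_digraph vs] by blast
qed

lemma graph_spectral_radius_ge:
  fixes l :: complex
  assumes "fin_digraph G" "\<exists>u\<in>verts G. x u \<noteq> 0"
    "\<And>u. u \<in> verts G \<Longrightarrow> (\<Sum>w\<in>arcs_ends G `` {u}. x w) = l * x u"
  shows "norm l \<le> graph_spectral_radius G"
proof -
  interpret fin_digraph G by fact
  obtain vs where vs: "distinct vs" "set vs = verts G"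
    using finite_distinct_list[OF finite_verts] by blast
  let ?A = "adjacency_matrix G vs"
  have A: "?A \<in> carrier_mat (length vs) (length vs)" "0 < length vs"
    using assms(2) vs by (auto simp: adjacency_matrix_def)
  have "l \<in> spectrum ?A"
    using spectrum_adjacency_matrix_iff[OF wf_digraph vs] assms(2,3) by blast
  then show ?thesis
    unfolding graph_spectral_radius_eq[OF vs] using spectral_radius_mem_max(2)[OF A] by blast
qed

text \<open>Mapping an enumeration of the vertices along the isomorphism yields the very same
  matrix.\<close>

lemma graph_spectral_radius_iso:
  assumes "fin_digraph G" "digraph_iso G H"
  shows "graph_spectral_radius G = graph_spectral_radius H"
proof -
  interpret fin_digraph G by fact
  obtain f where f: "digraph_isomorphism f" "H = app_iso f G"
    using assms(2) by (auto simp: digraph_iso_def)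
  obtain vs where vs: "distinct vs" "set vs = verts G"
    using finite_distinct_list[OF finite_verts] by blast
  let ?h = "iso_verts f"
  have inj: "inj_on ?h (verts G)" using f(1) by (rule digraph_isomorphism_inj_on_verts)
  have ws: "distinct (map ?h vs)" "set (map ?h vs) = verts H"
    using vs inj f(2) by (auto simp: distinct_map)
  have E: "arcs_ends H = (\<lambda>(u, w). (?h u, ?h w)) ` arcs_ends G"
    using f by (simp add: arcs_ends_conv image_image iso_verts_tail iso_verts_head)
  have "(?h u, ?h w) \<in> arcs_ends H \<longleftrightarrow> (u, w) \<in> arcs_ends G"
    if "u \<in> verts G" "w \<in> verts G" for u w
    unfolding E using that inj by (auto dest: inj_onD adj_in_verts)
  moreover have "i < length vs \<Longrightarrow> vs ! i \<in> verts G" for i using vs(2) nth_mem by blast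
  ultimately have "adjacency_matrix H (map ?h vs) = adjacency_matrix G vs"
    unfolding adjacency_matrix_def by (intro eq_matI) auto
  then show ?thesis
    by (simp add: graph_spectral_radius_eq[OF vs] graph_spectral_radius_eq[OF ws])
qed

section \<open>The spectral bound from a positive test vector\<close>

text \<open>This is a Collatz-Wielandt comparison. Scale \<open>z\<close> by the least
  \<open>t\<close> with \<open>norm (x u) \<le> t * z u\<close> everywhere and compare both sides at
  a vertex where this is an equality. If \<open>norm l = r\<close>, equality at a vertex forces
  equality at its neighbours, and connectedness spreads it to all of \<open>V\<close>.\<close>

lemma weighted_eigenvalue_bound:
  fixes x :: "'a \<Rightarrow> complex" and z :: "'a \<Rightarrow> real"
  assumes V: "finite V" "E \<subseteq> V \<times> V" and z: "\<And>u. u \<in> V \<Longrightarrow> 0 < z u"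
    and sup: "\<And>u. u \<in> V \<Longrightarrow> (\<Sum>w\<in>E `` {u}. z w) \<le> r * z u"
    and x: "\<exists>u\<in>V. x u \<noteq> 0" "\<And>u. u \<in> V \<Longrightarrow> (\<Sum>w\<in>E `` {u}. x w) = l * x u"
  shows "norm l \<le> r"
    and "norm l = r \<Longrightarrow> (\<And>T. T \<noteq> {} \<Longrightarrow> T \<subset> V \<Longrightarrow> \<exists>a\<in>T. \<exists>b\<in>V - T. (a, b) \<in> E) \<Longrightarrow> u \<in> V
      \<Longrightarrow> (\<Sum>w\<in>E `` {u}. z w) = r * z u"
proof -
  define t where "t = Max ((\<lambda>u. norm (x u) / z u) ` V)"
  have V0: "V \<noteq> {}" using x(1) by blast
  have le: "norm (x u) \<le> t * z u" if "u \<in> V" for u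
  proof -
    have "norm (x u) / z u \<le> t" unfolding t_def using V that by (intro Max_ge) auto
    then show ?thesis using z[OF that] by (simp add: field_simps)
  qed
  have "t \<in> (\<lambda>u. norm (x u) / z u) ` V"
    unfolding t_def using V V0 by (intro Max_in) auto
  then obtain u0 where u0: "u0 \<in> V" "t = norm (x u0) / z u0" by blast
  then have u0': "norm (x u0) = t * z u0" using z[OF u0(1)] by simp
  have t: "t > 0"
  proof -
    obtain u where u: "u \<in> V" "x u \<noteq> 0" using x by blast
    then have "0 < t * z u" using le[OF u(1)] by (meson less_le_trans zero_less_norm_iff)
    then show ?thesis using z[OF u(1)] by (simp add: zero_less_mult_iff)
  qed
  have nb: "E `` {u} \<subseteq> V" "finite (E `` {u})" for u
    using V by (auto intro: finite_subset)
  \<comment> \<open>The links are kept apart because in the equality case each of them becomes an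
    equality.\<close>
  have chain: "norm l * norm (x u) \<le> (\<Sum>w\<in>E `` {u}. norm (x w))"
      "(\<Sum>w\<in>E `` {u}. norm (x w)) \<le> (\<Sum>w\<in>E `` {u}. t * z w)"
      "(\<Sum>w\<in>E `` {u}. t * z w) = t * (\<Sum>w\<in>E `` {u}. z w)"
      "t * (\<Sum>w\<in>E `` {u}. z w) \<le> t * (r * z u)"
    if u: "u \<in> V" for u
  proof -
    have "norm l * norm (x u) = norm (\<Sum>w\<in>E `` {u}. x w)"
      using x(2)[OF u] by (simp add: norm_mult)
    also have "\<dots> \<le> (\<Sum>w\<in>E `` {u}. norm (x w))" by (rule norm_sum)
    finally show "norm l * norm (x u) \<le> (\<Sum>w\<in>E `` {u}. norm (x w))" .
    show "(\<Sum>w\<in>E `` {u}. norm (x w)) \<le> (\<Sum>w\<in>E `` {u}. t * z w)"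
      using le nb by (intro sum_mono) blast
    show "(\<Sum>w\<in>E `` {u}. t * z w) = t * (\<Sum>w\<in>E `` {u}. z w)"
      by (simp add: sum_distrib_left)
    show "t * (\<Sum>w\<in>E `` {u}. z w) \<le> t * (r * z u)"
      using sup[OF u] t by (intro mult_left_mono) auto
  qed
  have "norm l * (t * z u0) \<le> r * (t * z u0)"
    using chain[OF u0(1)] u0' by (simp add: algebra_simps)
  moreover have "0 < t * z u0" using t z u0(1) by simp
  ultimately show "norm l \<le> r" by (simp only: mult_le_cancel_right_pos)
  assume eq: "norm l = r" and
    conn: "\<And>T. T \<noteq> {} \<Longrightarrow> T \<subset> V \<Longrightarrow> \<exists>a\<in>T. \<exists>b\<in>V - T. (a, b) \<in> E" and u: "u \<in> V"
  define T where "T = {u \<in> V. norm (x u) = t * z u}"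
  have tight: "(\<Sum>w\<in>E `` {u}. norm (x w)) = (\<Sum>w\<in>E `` {u}. t * z w)"
      "(\<Sum>w\<in>E `` {u}. z w) = r * z u" if "u \<in> T" for u
  proof -
    have u: "u \<in> V" "norm (x u) = t * z u" using that by (auto simp: T_def)
    have e: "norm l * norm (x u) = t * (r * z u)" using u eq by simp
    show "(\<Sum>w\<in>E `` {u}. norm (x w)) = (\<Sum>w\<in>E `` {u}. t * z w)"
      using chain[OF u(1)] e by linarith
    have "t * (\<Sum>w\<in>E `` {u}. z w) = t * (r * z u)"
      using chain[OF u(1)] e by linarith
    then show "(\<Sum>w\<in>E `` {u}. z w) = r * z u" using t by simp
  qed
  have "T = V"
  proof (rule ccontr)
    assume "T \<noteq> V"
    then have "T \<subset> V" "T \<noteq> {}" using u0(1) u0' by (auto simp: T_def)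
    obtain a b where ab: "a \<in> T" "b \<in> V - T" "(a, b) \<in> E"
      using conn[OF \<open>T \<noteq> {}\<close> \<open>T \<subset> V\<close>] by (elim bexE)
    \<comment> \<open>The sums of \<open>norm (x w)\<close> and \<open>t * z w\<close> over the
      neighbours of \<open>a\<close> agree although they are ordered termwise, so they agree
      termwise, in particular at \<open>b\<close>.\<close>
    have "norm (x b) = t * z b"
    proof (rule sum_mono_inv[OF tight(1)[OF ab(1)]])
      show "norm (x w) \<le> t * z w" if "w \<in> E `` {a}" for w using that nb le by blast
    qed (use ab nb in auto)
    then show False using ab by (simp add: T_def)
  qed
  then show "(\<Sum>w\<in>E `` {u}. z w) = r * z u" using tight u by blast
qed

text \<open>Each neighbour \<open>w\<close> of \<open>u\<close> contributes its continuations away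
  from \<open>u\<close> and, by symmetry, exactly one step back to \<open>u\<close>.\<close>

lemma sum_degree_neighbours:
  assumes "finite V" "E \<subseteq> V \<times> V" "sym E"
  shows "(\<Sum>w\<in>E `` {u}. card (E `` {w})) = card (two_paths E u) + card (E `` {u})"
proof -
  have nb: "finite (E `` {w})" for w
    by (rule finite_subset[of _ V]) (use assms in auto)
  have "two_paths E u = (SIGMA w:E `` {u}. E `` {w} - {u})" by (auto simp: two_paths_def)
  then have "card (two_paths E u) = (\<Sum>w\<in>E `` {u}. card (E `` {w} - {u}))"
    using nb by simp
  also have "\<dots> + card (E `` {u}) = (\<Sum>w\<in>E `` {u}. card (E `` {w} - {u}) + 1)"
    by (simp only: sum.distrib card_eq_sum)
  also have "\<dots> = (\<Sum>w\<in>E `` {u}. card (E `` {w}))"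
  proof (rule sum.cong)
    fix w assume "w \<in> E `` {u}"
    then have "u \<in> E `` {w}" using symD[OF assms(3)] by auto
    then show "card (E `` {w} - {u}) + 1 = card (E `` {w})"
      using card.remove[OF nb] by simp
  qed simp
  finally show ?thesis by simp
qed

lemma graph_spectral_radius_le_two_paths:
  assumes G: "graph G" "verts G \<noteq> {}" and r: "1 < r" "r * (r - 1) = real k"
    and tp: "\<And>u. u \<in> verts G \<Longrightarrow> card (two_paths (arcs_ends G) u) \<le> k"
  shows "graph_spectral_radius G \<le> r"
    and "graph_spectral_radius G = r
      \<Longrightarrow> (\<And>T. T \<noteq> {} \<Longrightarrow> T \<subset> verts G \<Longrightarrow> \<exists>a\<in>T. \<exists>b\<in>verts G - T. (a, b) \<in> arcs_ends G)
      \<Longrightarrow> u \<in> verts G \<Longrightarrow> card (two_paths (arcs_ends G) u) = k"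
proof -
  interpret graph G by fact
  let ?E = "arcs_ends G"
  \<comment> \<open>The shift \<open>r - 1\<close> makes the degree terms of \<open>A z\<close> and
    \<open>r z\<close> cancel; since \<open>r * (r - 1) = k\<close>, what remains of
    \<open>A z - r z\<close> at \<open>u\<close> is the number of paths from \<open>u\<close> minus
    \<open>k\<close>.\<close>
  define z where "z u = real (card (?E `` {u})) + (r - 1)" for u
  have E: "?E \<subseteq> verts G \<times> verts G" "sym ?E"
    using sym_arcs by (auto simp: symmetric_def dest: adj_in_verts)
  have zsum: "(\<Sum>w\<in>?E `` {u}. z w) = real (card (two_paths ?E u)) + r * z u - real k" for u
  proof -
    have "(\<Sum>w\<in>?E `` {u}. z w) = real (\<Sum>w\<in>?E `` {u}. card (?E `` {w})) + real (card (?E `` {u})) * (r - 1)"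
      by (simp add: z_def sum.distrib)
    also have "\<dots> = real (card (two_paths ?E u)) + r * real (card (?E `` {u}))"
      unfolding sum_degree_neighbours[OF finite_verts E] by (simp add: algebra_simps)
    finally show ?thesis using r(2) by (simp add: z_def algebra_simps)
  qed
  obtain l :: complex and x where lx: "norm l = graph_spectral_radius G" "\<exists>u\<in>verts G. x u \<noteq> 0"
    "\<And>u. u \<in> verts G \<Longrightarrow> (\<Sum>w\<in>?E `` {u}. x w) = l * x u"
    using graph_spectral_radius_attained[OF fin_digraph_axioms G(2)] by blast
  have zpos: "0 < z u" for u using r by (simp add: z_def add_nonneg_pos)
  have zsup: "(\<Sum>w\<in>?E `` {u}. z w) \<le> r * z u" if "u \<in> verts G" for u
    using tp[OF that] zsum[of u] by simp
  note wb = weighted_eigenvalue_bound[OF finite_verts E(1) zpos zsup lx(2,3), unfolded lx(1)]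
  show "graph_spectral_radius G \<le> r" by (rule wb(1))
  assume "graph_spectral_radius G = r" "u \<in> verts G"
    "\<And>T. T \<noteq> {} \<Longrightarrow> T \<subset> verts G \<Longrightarrow> \<exists>a\<in>T. \<exists>b\<in>verts G - T. (a, b) \<in> ?E"
  then have "(\<Sum>w\<in>?E `` {u}. z w) = r * z u" by (intro wb(2))
  then show "card (two_paths ?E u) = k" using zsum[of u] by simp
qed

section \<open>An eigenvalue of the friendship graph\<close>

lemma pverts_friendship_graph:
  "pverts (friendship_graph k) = insert (Inl 0) (Inr ` ({..<k} \<times> {..<2}))"
  by (auto simp: friendship_graph_def graph_join_def complete_graph_def disjoint_copies_def)

lemma parcs_friendship_graph:
  "parcs (friendship_graph k) =
     {(Inl 0, Inr p) | p. p \<in> {..<k} \<times> {..<2}} \<union> {(Inr p, Inl 0) | p. p \<in> {..<k} \<times> {..<2}}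
     \<union> {(Inr p, Inr q) | p q. p \<in> {..<k} \<times> {..<2} \<and> q \<in> {..<k} \<times> {..<2} \<and> fst p = fst q \<and> p \<noteq> q}"
  by (auto simp: friendship_graph_def graph_join_def complete_graph_def disjoint_copies_def)

lemma graph_spectral_radius_friendship_ge:
  assumes r: "1 < r" "r * (r - 1) = real (2 * k)"
  shows "r \<le> graph_spectral_radius (with_proj (friendship_graph k))"
proof -
  let ?F = "with_proj (friendship_graph k)"
  interpret F: pair_graph "friendship_graph k" by (rule pair_graph_friendship_graph)
  \<comment> \<open>The centre gets \<open>r - 1\<close> and every other vertex 1. A vertex off the
    centre sees \<open>(r - 1) + 1 = r\<close>, and the centre sees
    \<open>2 * k = r * (r - 1)\<close>.\<close>
  define x :: "nat + nat \<times> nat \<Rightarrow> complex" where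
    "x = case_sum (\<lambda>_. complex_of_real (r - 1)) (\<lambda>_. 1)"
  have E: "arcs_ends ?F = parcs (friendship_graph k)" by (auto simp: arcs_ends_conv)
  have "norm (complex_of_real r) \<le> graph_spectral_radius ?F"
  proof (rule graph_spectral_radius_ge)
    show "fin_digraph ?F" by (rule F.fin_digraph_axioms)
    show "\<exists>u\<in>verts ?F. x u \<noteq> 0"
      using r by (auto simp: pverts_friendship_graph x_def)
    fix u assume "u \<in> verts ?F"
    then consider "u = Inl 0" | i j where "u = Inr (i, j)" "i < k" "j < 2"
      by (auto simp: pverts_friendship_graph)
    then show "(\<Sum>w\<in>arcs_ends ?F `` {u}. x w) = complex_of_real r * x u"
    proof cases
      case 1
      have "arcs_ends ?F `` {u} = Inr ` ({..<k} \<times> {..<2})"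
        unfolding E parcs_friendship_graph 1 by auto
      then have "(\<Sum>w\<in>arcs_ends ?F `` {u}. x w) = of_nat (2 * k)"
        by (simp add: x_def sum.reindex card_cartesian_product)
      also have "\<dots> = complex_of_real (r * (r - 1))" using r(2) by simp
      finally show ?thesis by (simp add: 1 x_def)
    next
      case 2
      have "arcs_ends ?F `` {u} = {Inl 0, Inr (i, 1 - j)}"
        unfolding E parcs_friendship_graph 2 using 2 by (auto simp: less_2_cases_iff)
      then show ?thesis by (simp add: 2 x_def)
    qed
  qed
  then show ?thesis using r by simp
qed

section \<open>Factor-critical graphs and friendship graphs\<close>

text \<open>An edge set \<open>M\<close> gives the map sending \<open>x\<close> to the other end of
  the unique edge of \<open>M\<close> at \<open>x\<close>; conversely a partner map gives the edges
  \<open>{x, m x}\<close>.\<close>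

lemma ex_perfect_matching_iff_matchable:
  assumes E: "sym (arcs_ends H)" "irrefl (arcs_ends H)"
  shows "(\<exists>M. perfect_matching H M) \<longleftrightarrow> matchable (arcs_ends H) (verts H)"
proof
  assume "\<exists>M. perfect_matching H M"
  then obtain M where M: "M \<subseteq> uedges H" "pairwise disjnt M" "\<Union>M = verts H"
    by (auto simp: perfect_matching_def matching_def)
  have edge: "(x, y) \<in> arcs_ends H" if xy: "{x, y} \<in> M" for x y
  proof -
    obtain u w where uw: "{x, y} = {u, w}" "(u, w) \<in> arcs_ends H"
      using M(1) xy by (auto simp: uedges_def)
    then show ?thesis using symD[OF E(1) uw(2)] by (auto simp: doubleton_eq_iff)
  qed
  have uniq: "y = y'" if "{x, y} \<in> M" "{x, y'} \<in> M" for x y y'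
  proof -
    have "{x, y} = {x, y'}"
      using pairwiseD[OF M(2) that] by (auto simp: disjnt_def)
    then show ?thesis by (auto simp: doubleton_eq_iff)
  qed
  have ex: "\<exists>y. {x, y} \<in> M" if x: "x \<in> verts H" for x
  proof -
    obtain e where e: "e \<in> M" "x \<in> e" using M(3) x by blast
    then obtain u w where "e = {u, w}" using M(1) by (auto simp: uedges_def)
    then have "e = {x, u} \<or> e = {x, w}" using e(2) by auto
    then show ?thesis using e(1) by blast
  qed
  define m where "m x = (THE y. {x, y} \<in> M)" for x
  have mI: "m x = y" if "{x, y} \<in> M" for x y
    unfolding m_def using that uniq by (intro the_equality) blast+
  have "m x \<in> verts H \<and> m (m x) = x \<and> (x, m x) \<in> arcs_ends H" if x: "x \<in> verts H" for x
  proof -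
    obtain y where y: "{x, y} \<in> M" using ex[OF x] by blast
    then have "{y, x} \<in> M" by (simp add: insert_commute)
    then show ?thesis using mI[OF y] mI edge[OF y] M(3) y by auto
  qed
  then show "matchable (arcs_ends H) (verts H)" unfolding matchable_def by blast
next
  assume "matchable (arcs_ends H) (verts H)"
  then obtain m where m: "\<And>x. x \<in> verts H \<Longrightarrow> m x \<in> verts H \<and> m (m x) = x \<and> (x, m x) \<in> arcs_ends H"
    unfolding matchable_def by blast
  define M where "M = (\<lambda>x. {x, m x}) ` verts H"
  have "M \<subseteq> uedges H" using m by (auto simp: M_def uedges_def)
  moreover have "pairwise disjnt M"
  proof (rule pairwiseI)
    fix e e' assume e: "e \<in> M" "e' \<in> M" "e \<noteq> e'"
    have mem: "e'' = {u, m u}" if "e'' \<in> M" "u \<in> e''" for e'' u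
      using that m by (auto simp: M_def)
    show "disjnt e e'"
    proof (rule ccontr)
      assume "\<not> disjnt e e'"
      then obtain u where u: "u \<in> e" "u \<in> e'" by (auto simp: disjnt_def)
      show False using mem[OF e(1) u(1)] mem[OF e(2) u(2)] e(3) by simp
    qed
  qed
  moreover have "\<Union>M = verts H" using m by (auto simp: M_def)
  ultimately show "\<exists>M. perfect_matching H M"
    by (auto simp: perfect_matching_def matching_def)
qed

lemma factor_critical_iff_matchable:
  assumes E: "sym (arcs_ends G)" "irrefl (arcs_ends G)"
  shows "factor_critical G \<longleftrightarrow> (\<forall>v\<in>verts G. matchable (arcs_ends G) (verts G - {v}))"
proof -
  have "(\<exists>M. perfect_matching (pre_digraph.del_vert G v) M)
      \<longleftrightarrow> matchable (arcs_ends G) (verts G - {v})" for v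
  proof -
    let ?H = "pre_digraph.del_vert G v"
    have H: "verts ?H = verts G - {v}" "arcs_ends ?H = arcs_ends G \<inter> {(a, b). a \<noteq> v \<and> b \<noteq> v}"
      by (auto simp: arcs_ends_conv pre_digraph.del_vert_simps)
    have "sym (arcs_ends ?H)" "irrefl (arcs_ends ?H)"
      using E unfolding H by (auto simp: sym_def irrefl_def)
    then have "(\<exists>M. perfect_matching ?H M) \<longleftrightarrow> matchable (arcs_ends ?H) (verts ?H)"
      by (rule ex_perfect_matching_iff_matchable)
    also have "\<dots> \<longleftrightarrow> matchable (arcs_ends G) (verts G - {v})"
      unfolding H matchable_def by (intro ex_cong1 ball_cong refl) auto
    finally show ?thesis .
  qed
  then show ?thesis by (simp add: factor_critical_def)
qed

text \<open>If \<open>F\<close> missed an edge, that edge could be deleted from \<open>G\<close> and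
  \<open>F\<close> would still supply a perfect matching of every \<open>G - w\<close>, against
  minimality.\<close>

lemma minimal_factor_critical_spanning_eq:
  assumes G: "sym (arcs_ends G)" "irrefl (arcs_ends G)" "minimal_factor_critical G"
    and F: "F \<subseteq> arcs_ends G" "sym F" "\<And>w. w \<in> verts G \<Longrightarrow> matchable F (verts G - {w})"
  shows "F = arcs_ends G"
proof (rule ccontr)
  assume "F \<noteq> arcs_ends G"
  then obtain x y where xy: "(x, y) \<in> arcs_ends G" "(x, y) \<notin> F" using F(1) by auto
  have yx: "(y, x) \<notin> F" using xy symD[OF F(2)] by blast
  let ?H = "del_uedge G {x, y}"
  have V: "verts ?H = verts G" by (simp add: del_uedge_def)
  have E: "arcs_ends ?H = arcs_ends G - {(x, y), (y, x)}"
    by (auto simp: arcs_ends_conv del_uedge_def doubleton_eq_iff)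
  have H: "sym (arcs_ends ?H)" "irrefl (arcs_ends ?H)"
    using G(1,2) unfolding E by (auto simp: sym_def irrefl_def)
  have "F \<subseteq> arcs_ends ?H" using F(1) xy yx unfolding E by blast
  then have "\<forall>w\<in>verts ?H. matchable (arcs_ends ?H) (verts ?H - {w})"
    using F(3) matchable_mono unfolding V by blast
  then have "factor_critical ?H" unfolding factor_critical_iff_matchable[OF H] .
  moreover have "{x, y} \<in> uedges G" using xy by (auto simp: uedges_def)
  ultimately show False using G(3) by (auto simp: minimal_factor_critical_def)
qed

text \<open>If no arc left \<open>T\<close>, every vertex reachable from \<open>T\<close> would lie
  in \<open>T\<close>, but symmetry makes \<open>G\<close> strongly connected. Both the start of an
  ear and the equality case of the spectral bound use connectedness in this form.\<close>

lemma (in wf_digraph) connected_leaves_subset: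
  assumes sym: "symmetric G" and con: "Digraph_Component.connected G" and T: "T \<noteq> {}" "T \<subset> verts G"
  shows "\<exists>a\<in>T. \<exists>b\<in>verts G - T. (a, b) \<in> arcs_ends G"
proof (rule ccontr)
  assume no: "\<not> ?thesis"
  obtain u w where uw: "u \<in> T" "w \<in> verts G - T" using T by blast
  have "strongly_connected G" by (rule symmetric_connected_imp_strongly_connected[OF sym con])
  then have "u \<rightarrow>\<^sup>* w" using uw T by (auto simp: strongly_connected_def)
  then have "w \<in> T"
  proof (induction rule: reachable_induct)
    case base then show ?case using uw by simp
  next
    case (step x y) then show ?case using no by (auto dest: adj_in_verts)
  qed
  then show False using uw by blast
qed

section \<open>The equality case\<close>

text \<open>From \<open>x\<close>, at most one path runs through \<open>y\<close> and at most
  \<open>deg p - 1\<close> run through \<open>p\<close>. As there are \<open>card V - 1\<close>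
  paths, \<open>p\<close> is adjacent to all other vertices. The paths from \<open>p\<close> are
  then exactly the arcs of \<open>G - p\<close>; their number is \<open>card V - 1\<close>, and the
  matching \<open>m\<close> alone already provides that many.\<close>

lemma two_paths_eq_friendship_structure:
  assumes V: "finite V" and E: "E \<subseteq> V \<times> V" "sym E" "irrefl E"
    and tp: "\<And>u. u \<in> V \<Longrightarrow> card (two_paths E u) = card V - 1"
    and x: "E `` {x} = {y, p}" "card (E `` {y}) \<le> 2"
    and m: "\<And>w. w \<in> V - {p} \<Longrightarrow> m w \<in> V - {p} \<and> m (m w) = w \<and> (w, m w) \<in> E"
  shows "E = {p} \<times> (V - {p}) \<union> (V - {p}) \<times> {p} \<union> (\<lambda>w. (w, m w)) ` (V - {p})"
proof -
  have nb: "finite (E `` {u})" "E `` {u} \<subseteq> V - {u}" for u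
    using V E(1,3) by (auto simp: irrefl_def intro: finite_subset)
  have xy: "(x, y) \<in> E" "(x, p) \<in> E" using x(1) by auto
  then have yx: "(y, x) \<in> E" "(p, x) \<in> E" using symD[OF E(2)] by auto
  have xV: "x \<in> V" and pV: "p \<in> V" using xy E(1) by auto
  have "two_paths E x \<subseteq> {y} \<times> (E `` {y} - {x}) \<union> {p} \<times> (E `` {p} - {x})"
  proof
    fix q assume "q \<in> two_paths E x"
    then obtain w u where q: "q = (w, u)" "(x, w) \<in> E" "(w, u) \<in> E" "u \<noteq> x"
      by (auto simp: two_paths_def)
    then have "w = y \<or> w = p" using x(1) by auto
    then show "q \<in> {y} \<times> (E `` {y} - {x}) \<union> {p} \<times> (E `` {p} - {x})" using q by auto
  qed
  then have "card (two_paths E x) \<le> card ({y} \<times> (E `` {y} - {x}) \<union> {p} \<times> (E `` {p} - {x}))"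
    using nb by (intro card_mono) auto
  also have "\<dots> \<le> card (E `` {y} - {x}) + card (E `` {p} - {x})"
    by (rule order_trans[OF card_Un_le]) (simp add: card_cartesian_product)
  also have "\<dots> = (card (E `` {y}) - 1) + (card (E `` {p}) - 1)"
    using yx nb by (simp add: card_Diff_singleton)
  also have "\<dots> \<le> 1 + (card (E `` {p}) - 1)" using x(2) by simp
  also have "\<dots> = card (E `` {p})"
    \<comment> \<open>The vertex \<open>x\<close> is a neighbour of \<open>p\<close>, so the
      truncated subtraction loses nothing.\<close>
    using yx(2) nb(1)[of p] card_gt_0_iff[of "E `` {p}"] by force
  finally have "card (V - {p}) \<le> card (E `` {p})"
    using tp[OF xV] V pV by simp
  then have pn: "E `` {p} = V - {p}"
    using nb[of p] V by (intro card_seteq) auto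
  let ?M = "(\<lambda>w. (w, m w)) ` (V - {p})"
  have "?M \<subseteq> two_paths E p" using m pn by (auto simp: two_paths_def)
  moreover have "card ?M = card (V - {p})" by (intro card_image inj_onI) auto
  then have "card (two_paths E p) \<le> card ?M" using tp[OF pV] V pV by simp
  ultimately have "?M = two_paths E p"
    using finite_two_paths[OF V E(1)] by (intro card_seteq)
  moreover have "two_paths E p = {(w, u). (w, u) \<in> E \<and> w \<noteq> p \<and> u \<noteq> p}"
    using pn E by (auto simp: two_paths_def)
  ultimately have M: "?M = {(w, u). (w, u) \<in> E \<and> w \<noteq> p \<and> u \<noteq> p}" by simp
  have pE: "(p, u) \<in> E \<longleftrightarrow> u \<in> V - {p}" for u using pn by auto
  have Ep: "(u, p) \<in> E \<longleftrightarrow> u \<in> V - {p}" for u using pE symD[OF E(2)] by blast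
  show ?thesis
  proof (rule Set.set_eqI)
    fix e :: "'a \<times> 'a"
    obtain u w where e: "e = (u, w)" by (cases e)
    show "e \<in> E \<longleftrightarrow> e \<in> {p} \<times> (V - {p}) \<union> (V - {p}) \<times> {p} \<union> ?M"
      unfolding M e using pE Ep by (cases "u = p"; cases "w = p") auto
  qed
qed

text \<open>The first component of \<open>h\<close> numbers the pairs of the involution, and the
  second distinguishes the two members. This gives both the evenness of \<open>card X\<close> and
  the copies of \<open>K_2\<close> in the isomorphism. The induction removes one pair
  \<open>a\<close>, \<open>m a\<close> at a time.\<close>

lemma involution_enumeration:
  assumes "finite X" "\<And>x. x \<in> X \<Longrightarrow> m x \<in> X \<and> m (m x) = x \<and> m x \<noteq> x"
  shows "\<exists>(k::nat) h. bij_betw h X ({..<k} \<times> {..<2::nat})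
    \<and> (\<forall>x\<in>X. \<forall>y\<in>X. y = m x \<longleftrightarrow> fst (h x) = fst (h y) \<and> x \<noteq> y)"
  using assms
proof (induction X rule: finite_psubset_induct)
  case (psubset X)
  show ?case
  proof (cases "X = {}")
    case True
    have "bij_betw (\<lambda>_. (0, 0)) X ({..<0::nat} \<times> {..<2::nat})" using True by (simp add: bij_betw_def)
    then show ?thesis using True by blast
  next
    case False
    then obtain a where a: "a \<in> X" by blast
    define b where "b = m a"
    have b: "b \<in> X" "m b = a" "a \<noteq> b" using psubset.prems[OF a] by (auto simp: b_def)
    let ?X = "X - {a, b}"
    have "\<exists>(k::nat) h. bij_betw h ?X ({..<k} \<times> {..<2::nat})
        \<and> (\<forall>x\<in>?X. \<forall>y\<in>?X. y = m x \<longleftrightarrow> fst (h x) = fst (h y) \<and> x \<noteq> y)"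
    proof (rule psubset.IH)
      show "?X \<subset> X" using a by blast
      show "m x \<in> ?X \<and> m (m x) = x \<and> m x \<noteq> x" if x: "x \<in> ?X" for x
      proof -
        have "m x \<noteq> a"
        proof
          assume "m x = a"
          then have "x = b" using psubset.prems[of x] x by (auto simp: b_def)
          then show False using x by simp
        qed
        moreover have "m x \<noteq> b"
        proof
          assume "m x = b"
          then have "x = a" using psubset.prems[of x] x b by auto
          then show False using x by simp
        qed
        ultimately show ?thesis using psubset.prems[of x] x by simp
      qed
    qed
    then obtain k :: nat and h where h: "bij_betw h ?X ({..<k} \<times> {..<2::nat})"
      and hm: "\<And>x y. x \<in> ?X \<Longrightarrow> y \<in> ?X \<Longrightarrow> y = m x \<longleftrightarrow> fst (h x) = fst (h y) \<and> x \<noteq> y"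
      by blast
    define g where "g = h(a := (k, 0), b := (k, 1))"
    have g: "g a = (k, 0)" "g b = (k, 1)" "\<And>x. x \<in> ?X \<Longrightarrow> g x = h x" using b by (auto simp: g_def)
    have "bij_betw g ?X ({..<k} \<times> {..<2})" 
      using h bij_betw_cong[of ?X g h, OF g(3)] by simp
    moreover have "bij_betw g {a, b} {(k, 0), (k, 1)}" using g b by (auto simp: bij_betw_def)
    ultimately have "bij_betw g (?X \<union> {a, b}) ({..<k} \<times> {..<2} \<union> {(k, 0), (k, 1)})"
      by (rule bij_betw_combine) auto
    moreover have "?X \<union> {a, b} = X" using a b by blast
    moreover have "{..<k} \<times> {..<2} \<union> {(k, 0), (k, 1)} = {..<Suc k} \<times> {..<2::nat}"
      by (auto simp: less_2_cases_iff)
    ultimately have bij: "bij_betw g X ({..<Suc k} \<times> {..<2})" by simp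
    have gk: "fst (g x) < k" if x: "x \<in> ?X" for x
    proof -
      have "h x \<in> {..<k} \<times> {..<2}" using h x by (rule bij_betw_apply)
      then show ?thesis using g(3)[OF x] by auto
    qed
    have "y = m x \<longleftrightarrow> fst (g x) = fst (g y) \<and> x \<noteq> y" if xy: "x \<in> X" "y \<in> X" for x y
    proof -
      have mm: "m (m x) = x" using psubset.prems[OF xy(1)] by simp
      consider "x \<in> ?X" "y \<in> ?X" | "x \<in> ?X" "y = a \<or> y = b" | "x = a" | "x = b" using xy by blast
      then show ?thesis
      proof cases
        case 1
        then show ?thesis using hm g by simp
      next
        case 2
        have "y \<noteq> m x"
        proof
          assume "y = m x"
          then have "m y = x" using mm by simp
          moreover have "m y = b \<or> m y = a" using 2(2) b(2) b_def[symmetric] by (elim disjE) simp_all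
          ultimately show False using 2(1) by auto
        qed
        moreover have "fst (g x) \<noteq> fst (g y)" using 2(2) g(1,2) gk[OF 2(1)] by auto
        ultimately show ?thesis by simp
      next
        case 3
        have "y = b \<longleftrightarrow> fst (g a) = fst (g y) \<and> a \<noteq> y"
          using g(1,2) gk[of y] xy(2) b(3) by (cases "y = a"; cases "y = b") simp_all
        then show ?thesis using 3 by (simp add: b_def)
      next
        case 4
        have "y = a \<longleftrightarrow> fst (g b) = fst (g y) \<and> b \<noteq> y"
          using g(1,2) gk[of y] xy(2) b(3) by (cases "y = a"; cases "y = b") simp_all
        then show ?thesis using 4 b by simp
      qed
    qed
    then show ?thesis using bij by blast
  qed
qed

text \<open>Without parallel arcs an arc is determined by its ends, so a vertex bijection that
  respects adjacency extends to the arcs.\<close>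

lemma digraph_iso_with_projI:
  assumes "nomulti_digraph G" and g: "bij_betw g (verts G) (pverts F)"
    and F: "parcs F \<subseteq> pverts F \<times> pverts F"
    and adj: "\<And>u w. u \<in> verts G \<Longrightarrow> w \<in> verts G \<Longrightarrow> (u, w) \<in> arcs_ends G \<longleftrightarrow> (g u, g w) \<in> parcs F"
  shows "digraph_iso G (with_proj F)"
proof -
  interpret nomulti_digraph G by fact
  define f where "f = \<lparr>iso_verts = g, iso_arcs = (\<lambda>a. (g (tail G a), g (head G a))),
    iso_head = snd, iso_tail = fst\<rparr>"
  have inj: "inj_on g (verts G)" and im: "g ` verts G = pverts F"
    using g by (auto simp: bij_betw_def)
  have "inj_on (iso_arcs f) (arcs G)"
  proof (rule inj_onI)
    fix a b assume ab: "a \<in> arcs G" "b \<in> arcs G" "iso_arcs f a = iso_arcs f b"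
    then have "tail G a = tail G b" "head G a = head G b"
      using inj by (auto simp: f_def dest: inj_onD)
    then show "a = b" using ab no_multi_arcs by (simp add: arc_to_ends_def)
  qed
  then have iso: "digraph_isomorphism f"
    using inj wf_digraph by (simp add: digraph_isomorphism_def f_def)
  have "(\<lambda>a. (g (tail G a), g (head G a))) ` arcs G = parcs F"
  proof
    show "(\<lambda>a. (g (tail G a), g (head G a))) ` arcs G \<subseteq> parcs F"
    proof
      fix e assume "e \<in> (\<lambda>a. (g (tail G a), g (head G a))) ` arcs G"
      then obtain a where a: "a \<in> arcs G" "e = (g (tail G a), g (head G a))" by blast
      then have "(tail G a, head G a) \<in> arcs_ends G" by (auto simp: arcs_ends_conv)
      then show "e \<in> parcs F" using adj a by simp
    qed
    show "parcs F \<subseteq> (\<lambda>a. (g (tail G a), g (head G a))) ` arcs G"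
    proof
      fix e assume e: "e \<in> parcs F"
      then obtain u w where uw: "e = (g u, g w)" "u \<in> verts G" "w \<in> verts G"
        using F im by blast
      then have "(u, w) \<in> arcs_ends G" using adj e by simp
      then obtain a where "a \<in> arcs G" "u = tail G a" "w = head G a" by (auto simp: arcs_ends_conv)
      then show "e \<in> (\<lambda>a. (g (tail G a), g (head G a))) ` arcs G" using uw by blast
    qed
  qed
  then have "with_proj F = app_iso f G"
    using im by (simp add: app_iso_def f_def with_proj_def)
  then show ?thesis using iso by (auto simp: digraph_iso_def)
qed

lemma digraph_iso_friendship_graph:
  assumes "graph G" and p: "p \<in> verts G"
    and m: "\<And>w. w \<in> verts G - {p} \<Longrightarrow> m w \<in> verts G - {p} \<and> m (m w) = w \<and> m w \<noteq> w"
    and E: "arcs_ends G = {p} \<times> (verts G - {p}) \<union> (verts G - {p}) \<times> {p}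
      \<union> (\<lambda>w. (w, m w)) ` (verts G - {p})"
  shows "digraph_iso G (with_proj (friendship_graph ((card (verts G) - 1) div 2)))"
proof -
  interpret graph G by fact
  let ?X = "verts G - {p}"
  have "\<exists>(k::nat) h. bij_betw h ?X ({..<k} \<times> {..<2::nat})
      \<and> (\<forall>x\<in>?X. \<forall>y\<in>?X. y = m x \<longleftrightarrow> fst (h x) = fst (h y) \<and> x \<noteq> y)"
    by (rule involution_enumeration) (simp, rule m)
  then obtain k :: nat and h where h: "bij_betw h ?X ({..<k} \<times> {..<2::nat})"
    and hm: "\<And>x y. x \<in> ?X \<Longrightarrow> y \<in> ?X \<Longrightarrow> y = m x \<longleftrightarrow> fst (h x) = fst (h y) \<and> x \<noteq> y"
    by (elim exE conjE) blast
  have "card ?X = 2 * k" using bij_betw_same_card[OF h] by (simp add: card_cartesian_product)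
  then have k: "(card (verts G) - 1) div 2 = k" using p by simp
  have hx: "h x \<in> {..<k} \<times> {..<2}" if "x \<in> ?X" for x using h that by (rule bij_betw_apply)
  have hinj: "h x = h y \<longleftrightarrow> x = y" if "x \<in> ?X" "y \<in> ?X" for x y
    using h that by (auto simp: bij_betw_def dest: inj_onD)
  \<comment> \<open>The vertex \<open>p\<close> becomes the centre, and the pair with number
    \<open>i\<close> becomes the \<open>i\<close>-th copy of \<open>K_2\<close>.\<close>
  define g :: "'a \<Rightarrow> nat + nat \<times> nat" where "g u = (if u = p then Inl 0 else Inr (h u))" for u
  have "bij_betw g ?X (Inr ` ({..<k} \<times> {..<2}))"
  proof -
    have "bij_betw (Inr \<circ> h) ?X (Inr ` ({..<k} \<times> {..<2}))"
      using h by (rule bij_betw_trans) (simp add: bij_betw_def)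
    then show ?thesis by (rule bij_betw_cong[THEN iffD1, rotated]) (auto simp: g_def)
  qed
  moreover have "bij_betw g {p} {Inl 0}" by (simp add: g_def bij_betw_def)
  ultimately have "bij_betw g (?X \<union> {p}) (Inr ` ({..<k} \<times> {..<2}) \<union> {Inl 0})"
    by (rule bij_betw_combine) auto
  moreover have "?X \<union> {p} = verts G" using p by blast
  ultimately have bij: "bij_betw g (verts G) (pverts (friendship_graph k))"
    by (simp add: pverts_friendship_graph)
  interpret F: pair_graph "friendship_graph k" by (rule pair_graph_friendship_graph)
  have "digraph_iso G (with_proj (friendship_graph k))"
  proof (rule digraph_iso_with_projI[OF nomulti_digraph bij])
    show "parcs (friendship_graph k) \<subseteq> pverts (friendship_graph k) \<times> pverts (friendship_graph k)"
      by (auto simp: pverts_friendship_graph parcs_friendship_graph)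
    fix u w assume uw: "u \<in> verts G" "w \<in> verts G"
    show "(u, w) \<in> arcs_ends G \<longleftrightarrow> (g u, g w) \<in> parcs (friendship_graph k)"
    proof (cases "u = p \<or> w = p")
      case True
      then show ?thesis
        using uw hx[of u] hx[of w] unfolding E parcs_friendship_graph by (auto simp: g_def dest: m)
    next
      case False
      then have X: "u \<in> ?X" "w \<in> ?X" using uw by auto
      have "(u, w) \<in> arcs_ends G \<longleftrightarrow> w = m u" unfolding E using False X by auto
      also have "\<dots> \<longleftrightarrow> fst (h u) = fst (h w) \<and> h u \<noteq> h w" using hm hinj X by simp
      also have "\<dots> \<longleftrightarrow> (g u, g w) \<in> parcs (friendship_graph k)"
        using False hx[OF X(1)] hx[OF X(2)] unfolding parcs_friendship_graph
        by (auto simp: g_def)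
      finally show ?thesis .
    qed
  qed
  then show ?thesis unfolding k .
qed

section \<open>Minimal factor-critical graphs and the extremal graph\<close>

text \<open>The spanning subgraph built from ears is itself factor-critical, so by minimality it has
  every edge of \<open>G\<close>. Since \<open>v\<close> is arbitrary, the bound on
  \<open>two_paths\<close> holds at every vertex.\<close>

lemma minimal_factor_critical_odd_ear_graph:
  assumes "graph G" "Digraph_Component.connected G" "minimal_factor_critical G" and v: "v \<in> verts G"
  shows "odd_ear_graph v (verts G) (arcs_ends G)"
proof -
  interpret graph G by fact
  have s: "sym (arcs_ends G)" using sym_arcs by (simp add: symmetric_def)
  have ir: "irrefl (arcs_ends G)" using no_loops by (auto simp: irrefl_def arcs_ends_conv)
  interpret factor_critical_rel "verts G" "arcs_ends G"
  proof
    show "matchable (arcs_ends G) (verts G - {w})" if "w \<in> verts G" for w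
      using assms(3) that factor_critical_iff_matchable[OF s ir]
      by (simp add: minimal_factor_critical_def)
    show "\<exists>a\<in>T. \<exists>b\<in>verts G - T. (a, b) \<in> arcs_ends G" if "T \<noteq> {}" "T \<subset> verts G" for T
      by (rule connected_leaves_subset[OF sym_arcs assms(2) that])
  qed (use s ir in \<open>auto dest: adj_in_verts\<close>)
  obtain F where F: "F \<subseteq> arcs_ends G" "odd_ear_graph v (verts G) F"
    using spanning_odd_ear_graph[OF v] by blast
  have "F = arcs_ends G"
    by (rule minimal_factor_critical_spanning_eq[OF s ir assms(3) F(1)])
      (use F(2) in \<open>auto simp: odd_ear_graph_def\<close>)
  then show ?thesis using F(2) by simp
qed

theorem theorem1p2:
  fixes G :: "('a, 'b) pre_digraph" and n :: nat
  assumes "graph G" and "Digraph_Component.connected G"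
    and "minimal_factor_critical G"
    and "card (verts G) = n"
  shows "graph_spectral_radius G
           \<le> graph_spectral_radius (with_proj (friendship_graph ((n - 1) div 2)))
       \<and> (graph_spectral_radius G
            = graph_spectral_radius (with_proj (friendship_graph ((n - 1) div 2)))
          \<longleftrightarrow> digraph_iso G (with_proj (friendship_graph ((n - 1) div 2))))"
proof -
  interpret graph G by fact
  let ?V = "verts G" and ?E = "arcs_ends G"
  define k where "k = (n - 1) div 2"
  let ?F = "with_proj (friendship_graph k)"
  have ear: "odd_ear_graph v ?V ?E" if "v \<in> ?V" for v
    by (rule minimal_factor_critical_odd_ear_graph[OF assms(1-3) that])
  have V0: "?V \<noteq> {}"
    using symmetric_connected_imp_strongly_connected[OF sym_arcs assms(2)]
    by (simp add: strongly_connected_def)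
  then obtain v where v: "v \<in> ?V" by blast
  have E: "?E \<subseteq> ?V \<times> ?V" "sym ?E" "irrefl ?E"
    using ear[OF v] by (auto simp: odd_ear_graph_def)
  have matching: "\<exists>m. \<forall>w\<in>?V - {p}. m w \<in> ?V - {p} \<and> m (m w) = w \<and> (w, m w) \<in> ?E"
    if "p \<in> ?V" for p
    using ear[OF that] that unfolding odd_ear_graph_def matchable_def by blast
  have ne: "m w \<noteq> w" if "(w, m w) \<in> ?E" for m w
  proof
    assume "m w = w"
    then have "(w, w) \<in> ?E" using that by simp
    then show False using E(3) by (simp add: irrefl_def)
  qed
  have isoI: "digraph_iso G ?F"
    if p: "p \<in> ?V" and m: "\<And>w. w \<in> ?V - {p} \<Longrightarrow> m w \<in> ?V - {p} \<and> m (m w) = w \<and> (w, m w) \<in> ?E"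
      and W: "?E = {p} \<times> (?V - {p}) \<union> (?V - {p}) \<times> {p} \<union> (\<lambda>w. (w, m w)) ` (?V - {p})" for p m
  proof -
    have "digraph_iso G (with_proj (friendship_graph ((card ?V - 1) div 2)))"
      by (rule digraph_iso_friendship_graph[OF assms(1) p _ W]) (use m ne in blast)
    then show ?thesis using assms(4) by (simp add: k_def)
  qed
  have "graph_spectral_radius G \<le> graph_spectral_radius ?F
      \<and> (graph_spectral_radius G = graph_spectral_radius ?F \<longleftrightarrow> digraph_iso G ?F)"
  proof (cases "?V = {v}")
    \<comment> \<open>For a single vertex \<open>k = 0\<close>, the root \<open>r\<close> would be 1
      and there is no last ear; here the isomorphism is immediate.\<close>
    case True
    have "?E = {}" using E(1,3) True by (auto simp: irrefl_def)
    then have iso: "digraph_iso G ?F" using True by (intro isoI[OF v, of id]) auto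
    then show ?thesis using graph_spectral_radius_iso[OF fin_digraph_axioms iso] by simp
  next
    case False
    obtain m where "\<forall>w\<in>?V - {v}. m w \<in> ?V - {v} \<and> m (m w) = w \<and> (w, m w) \<in> ?E"
      using matching[OF v] by blast
    then have m: "m w \<in> ?V - {v} \<and> m (m w) = w \<and> m w \<noteq> w" if "w \<in> ?V - {v}" for w
      using that ne by blast
    \<comment> \<open>The matching of \<open>G - v\<close> shows that \<open>n - 1\<close> is even,
      so the division by 2 in \<open>k\<close> is exact.\<close>
    have "\<exists>(k::nat) h. bij_betw h (?V - {v}) ({..<k} \<times> {..<2::nat})
      \<and> (\<forall>x\<in>?V - {v}. \<forall>y\<in>?V - {v}. y = m x \<longleftrightarrow> fst (h x) = fst (h y) \<and> x \<noteq> y)"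
      by (rule involution_enumeration) (simp, rule m)
    then obtain j :: nat and h where "bij_betw h (?V - {v}) ({..<j} \<times> {..<2::nat})" by blast
    from bij_betw_same_card[OF this] have "n - 1 = 2 * j"
      using v assms(4) by (simp add: card_cartesian_product)
    then have nk: "n - 1 = 2 * k" by (simp add: k_def)
    have "card {v} < card ?V" using v False by (intro psubset_card_mono) auto
    then have k: "k > 0" using nk assms(4) by simp
    \<comment> \<open>This is the positive root of \<open>r^2 - r - 2 * k\<close>.\<close>
    define r where "r = (1 + sqrt (1 + 8 * real k)) / 2"
    have r: "1 < r" "r * (r - 1) = real (2 * k)"
      using k by (auto simp: r_def field_simps)
    have tp: "card (two_paths ?E u) \<le> 2 * k" if "u \<in> ?V" for u
      using ear[OF that] nk assms(4) by (auto simp: odd_ear_graph_def)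
    note bound = graph_spectral_radius_le_two_paths[OF assms(1) V0 r]
    have G_le: "graph_spectral_radius G \<le> r" by (rule bound(1)) (rule tp)
    have F: "r \<le> graph_spectral_radius ?F" by (rule graph_spectral_radius_friendship_ge[OF r])
    have "digraph_iso G ?F" if eq: "graph_spectral_radius G = graph_spectral_radius ?F"
    proof -
      \<comment> \<open>The number \<open>r\<close> lies between the two spectral radii, so their
        equality squeezes it.\<close>
      have "graph_spectral_radius G = r" using G_le F eq by linarith
      then have "card (two_paths ?E u) = 2 * k" if "u \<in> ?V" for u
        using tp connected_leaves_subset[OF sym_arcs assms(2)] that by (intro bound(2))
      then have tp_eq: "card (two_paths ?E u) = card ?V - 1" if "u \<in> ?V" for u
        using that nk assms(4) by simp
      \<comment> \<open>As \<open>G\<close> has more than one vertex, there is a last ear, and it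
        provides these vertices.\<close>
      obtain x y p where x: "?E `` {x} = {y, p}" "card (?E `` {y}) \<le> 2"
        using ear[OF v] False by (auto simp: odd_ear_graph_def)
      have "(x, p) \<in> ?E" using x(1) by blast
      then have p: "p \<in> ?V" using E(1) by blast
      obtain m' where m': "\<And>w. w \<in> ?V - {p} \<Longrightarrow> m' w \<in> ?V - {p} \<and> m' (m' w) = w \<and> (w, m' w) \<in> ?E"
        using matching[OF p] by blast
      have W: "?E = {p} \<times> (?V - {p}) \<union> (?V - {p}) \<times> {p} \<union> (\<lambda>w. (w, m' w)) ` (?V - {p})"
        by (rule two_paths_eq_friendship_structure[OF finite_verts E _ x]) (rule tp_eq m', assumption)+
      show ?thesis by (rule isoI[OF p _ W]) (rule m')
    qed
    moreover have "graph_spectral_radius G \<le> graph_spectral_radius ?F"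
      using G_le F by linarith
    ultimately show ?thesis
      using graph_spectral_radius_iso[OF fin_digraph_axioms, of ?F] by blast
  qed
  then show ?thesis unfolding k_def .
qed

end
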